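(* Let $G$ be a higher pre-category and let $f$ be a cell of $G$. Given a bi-invertible structure $(f^\star,{}^\star f,f_R,f_L,f_R^{BI},f_L^{BI})$ on $f$, one can generate a bi-invertible structure on ${}^\star f$ and a bi-invertible structure on $f^\star$.
   Context: **Globular sets.** The globe category $\mathbb G$ has the natural numbers as objects and morphisms generated by $\sigma_n,\tau_n:n\to n+1$ subject to $\sigma_{n+1}\circ\sigma_n=\tau_{n+1}\circ\sigma_n$ and $\sigma_{n+1}\circ\tau_n=\tau_{n+1}\circ\tau_n$. A globular set $G$ is a presheaf on $\mathbb G$; elements of $G(n)$ are $n$-cells, and for $n$-cells $x,y$ we write $f:x\to y$ for an $(n+1)$-cell $f$ with source $G(\sigma_n)(f)=x$ and target $G(\tau_n)(f)=y$. **Identities and composition.** A globular set with identities and composition is a globular set $G$ with, for each $n$-cell $x$, an $(n+1)$-cell $\mathrm{id}_x:x\to x$, and compositions defined inductively: given $n$-cells $f:x\to y$, $g:y\to z$ there is an $n$-cell $g\star_0 f:x\to z$; given $\alpha:f\to g$ and $\beta:h\to j$ such that $f\star_n h$ and $g\star_n j$ are well-defined, there is a cell $\alpha\star_{n+1}\beta:(f\star_n h)\to(g\star_n j)$. No equations are imposed. **Quasi-invertible structure (coinductive definition).** Let $G$ be a globular set with identities and composition. A quasi-invertible structure on an $n$-cell $f:x\to y$ ($n>0$) is a tuple $(f^{-1},f_R,f_L,f_R^{QI},f_L^{QI})$ where $f^{-1}:y\to x$ is an $n$-cell, $f_R: f\star_0 f^{-1}\to\mathrm{id}_y$ and $f_L:f^{-1}\star_0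 f\to\mathrm{id}_x$ are $(n+1)$-cells, $f_R^{QI}$ is a quasi-invertible structure on $f_R$, and $f_L^{QI}$ is a quasi-invertible structure on $f_L$. **Hom globular sets.** For $n$-cells $x,y$ of $G$ with the same source and target (no condition if $n=0$), $G_{x,y}$ is the globular set whose $0$-cells are the $(n+1)$-cells of $G$ with source $x$ and target $y$, and whose $m$-cells are the $(n+m+1)$-cells of $G$ whose source and target are $(m-1)$-cells of $G_{x,y}$; it inherits identities and composition from $G$. **Graphical calculus.** The usual string diagrams for bicategories are used: areas represent $0$-cells, lines $1$-cells, nodes $2$-cells (read bottom to top, with $1$-cells composed by $\star_0$ placed side by side). A diagram represents a $2$-cell obtained by composing its constituents, with some bracketing and with unitors, associators and their inverses (below) inserted where needed. A globular set respects the graphical calculus if for any well-typed string diagram and any planar isotopy of it there is a $3$-cell from the $2$-cell represented by the source of the isotopy to the $2$-cell represented by its target, and this $3$-cell carries a quasi-invertible structure. **Higher pre-category.** A globular set $G$ with identities and composition such that $G$ and every $G_{x,y}$ respect the graphical calculus, together with the following cells, each equipped with a quasi-invertible structure: for $n>0$ and each $n$-cell $f:x\to y$, unitors $\lambda_f:\mathrm{id}_y\star_0 f\to f$ and $\rho_f:f\star_0\mathrm{id}_x\to f$; for composable $n$-cells $f,g,h$ with $n>0$, an associator $a_{f,g,h}:(f\star_0 g)\star_0 h\to f\star_0(g\star_0 h)$; for compatible cells $f,g,h,j$ and $n>0$, an interchanger $i_{f,g,h,j}:(f\star_n g)\star_0(h\star_n j)\to(f\star_0 h)\star_n(g\star_0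 j)$; for suitable $f,g$ and $n$, a cell $\mathrm{id}_f\star_{n+1}\mathrm{id}_g\to\mathrm{id}_{f\star_n g}$. **Bi-invertible structure (coinductive definition).** For $n>0$, a bi-invertible structure on an $n$-cell $f:x\to y$ is a tuple $(f^\star,{}^\star f,f_R,f_L,f_R^{BI},f_L^{BI})$ where $f^\star:y\to x$ and ${}^\star f:y\to x$ are $n$-cells, $f_R:f\star_0 f^\star\to\mathrm{id}_y$ and $f_L:{}^\star f\star_0 f\to\mathrm{id}_x$ are $(n+1)$-cells, $f_R^{BI}$ is a bi-invertible structure on $f_R$, and $f_L^{BI}$ is a bi-invertible structure on $f_L$. *)

theory Defs
  imports Complex_Main
begin

section \<open>Globular sets\<close>

text \<open>
  A presheaf on the globe category is given by its sets of cells and by the images of the generators;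
  the source and target maps at index \<open>n\<close> go from \<open>(n+1)\<close>-cells to \<open>n\<close>-cells.
\<close>

record 'a globular_data =
  cells :: "nat \<Rightarrow> 'a set"
  src :: "nat \<Rightarrow> 'a \<Rightarrow> 'a"
  tgt :: "nat \<Rightarrow> 'a \<Rightarrow> 'a"

definition arrow :: "('a, 'm) globular_data_scheme \<Rightarrow> nat \<Rightarrow> 'a \<Rightarrow> 'a \<Rightarrow> 'a \<Rightarrow> bool" where
  "arrow G n f x y \<longleftrightarrow>
     x \<in> cells G n \<and> y \<in> cells G n \<and> f \<in> cells G (Suc n) \<and> src G n f = x \<and> tgt G n f = y"

locale globular_set =
  fixes G :: "('a, 'm) globular_data_scheme"
  assumes src_closed: "f \<in> cells G (Suc n) \<Longrightarrow> src G n f \<in> cells G n"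
    and tgt_closed: "f \<in> cells G (Suc n) \<Longrightarrow> tgt G n f \<in> cells G n"
    and src_src: "f \<in> cells G (Suc (Suc n)) \<Longrightarrow> src G n (src G (Suc n) f) = src G n (tgt G (Suc n) f)"
    and tgt_src: "f \<in> cells G (Suc (Suc n)) \<Longrightarrow> tgt G n (src G (Suc n) f) = tgt G n (tgt G (Suc n) f)"


section \<open>Identities and composition\<close>

text \<open>
  \<open>ident G n x\<close> is the identity \<open>(n+1)\<close>-cell on the \<open>n\<close>-cell \<open>x\<close>, and \<open>cmp G m k a b\<close> is the composite
  \<open>a \<star>\<^sub>k b\<close> of two \<open>m\<close>-cells.  The index \<open>k\<close> is the codimension of the shared boundary, minus one: \<open>\<star>\<^sub>0\<close>
  glues two \<open>m\<close>-cells along an \<open>(m-1)\<close>-cell, \<open>\<star>\<^sub>1\<close> along an \<open>(m-2)\<close>-cell, and so on.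
\<close>

record 'a composition_data = "'a globular_data" +
  ident :: "nat \<Rightarrow> 'a \<Rightarrow> 'a"
  cmp :: "nat \<Rightarrow> nat \<Rightarrow> 'a \<Rightarrow> 'a \<Rightarrow> 'a"

fun composable :: "('a, 'm) globular_data_scheme \<Rightarrow> nat \<Rightarrow> nat \<Rightarrow> 'a \<Rightarrow> 'a \<Rightarrow> bool" where
  "composable G 0 k a b \<longleftrightarrow> False"
| "composable G (Suc m) 0 a b \<longleftrightarrow>
     a \<in> cells G (Suc m) \<and> b \<in> cells G (Suc m) \<and> src G m a = tgt G m b"
| "composable G (Suc m) (Suc k) a b \<longleftrightarrow>
     a \<in> cells G (Suc m) \<and> b \<in> cells G (Suc m) \<and>
     composable G m k (src G m a) (src G m b) \<and> composable G m k (tgt G m a) (tgt G m b)"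

locale globular_set_with_composition = globular_set G
  for G :: "('a, 'm) composition_data_scheme" +
  assumes ident_arrow: "x \<in> cells G n \<Longrightarrow> arrow G n (ident G n x) x x"
    and cmp_0_arrow: "composable G (Suc m) 0 g f \<Longrightarrow>
      arrow G m (cmp G (Suc m) 0 g f) (src G m f) (tgt G m g)"
    and cmp_Suc_arrow: "composable G (Suc m) (Suc k) a b \<Longrightarrow>
      arrow G m (cmp G (Suc m) (Suc k) a b)
        (cmp G m k (src G m a) (src G m b)) (cmp G m k (tgt G m a) (tgt G m b))"


section \<open>Quasi-invertible and bi-invertible structures\<close>

text \<open>
  The coinductive tuples are possibly infinite trees of cells; the coinductive predicates say that such
  a tree is a structure of the given kind on an \<open>n\<close>-cell \<open>f\<close>.  Both predicates force \<open>n > 0\<close>.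
\<close>

codatatype 'a qi = QI (qi_inv: 'a) (qi_R: 'a) (qi_L: 'a) (qi_R_qi: "'a qi") (qi_L_qi: "'a qi")

coinductive quasi_invertible_structure ::
  "('a, 'm) composition_data_scheme \<Rightarrow> nat \<Rightarrow> 'a \<Rightarrow> 'a qi \<Rightarrow> bool" for G where
  quasi_invertible_structure_intro:
  "\<lbrakk>arrow G n f x y; arrow G n g y x;
    arrow G (Suc n) fR (cmp G (Suc n) 0 f g) (ident G n y);
    arrow G (Suc n) fL (cmp G (Suc n) 0 g f) (ident G n x);
    quasi_invertible_structure G (Suc (Suc n)) fR qR;
    quasi_invertible_structure G (Suc (Suc n)) fL qL\<rbrakk>
   \<Longrightarrow> quasi_invertible_structure G (Suc n) f (QI g fR fL qR qL)"

codatatype 'a bi = BI (bi_right_inv: 'a) (bi_left_inv: 'a) (bi_R: 'a) (bi_L: 'a)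
  (bi_R_bi: "'a bi") (bi_L_bi: "'a bi")

coinductive bi_invertible_structure ::
  "('a, 'm) composition_data_scheme \<Rightarrow> nat \<Rightarrow> 'a \<Rightarrow> 'a bi \<Rightarrow> bool" for G where
  bi_invertible_structure_intro:
  "\<lbrakk>arrow G n f x y; arrow G n fstar y x; arrow G n starf y x;
    arrow G (Suc n) fR (cmp G (Suc n) 0 f fstar) (ident G n y);
    arrow G (Suc n) fL (cmp G (Suc n) 0 starf f) (ident G n x);
    bi_invertible_structure G (Suc (Suc n)) fR bR;
    bi_invertible_structure G (Suc (Suc n)) fL bL\<rbrakk>
   \<Longrightarrow> bi_invertible_structure G (Suc n) f (BI fstar starf fR fL bR bL)"


section \<open>Coherence data and hom globular sets\<close>

text \<open>
  In each field the first argument is the dimension of the cells \<open>f\<close>, \<open>g\<close>, \dots\ that follow; in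
  \<open>interchanger\<close> and \<open>ident_cmp\<close> the second argument is the composition index \<open>n\<close>.
\<close>

record 'a precategory_data = "'a composition_data" +
  lunitor :: "nat \<Rightarrow> 'a \<Rightarrow> 'a"
  lunitor_qi :: "nat \<Rightarrow> 'a \<Rightarrow> 'a qi"
  runitor :: "nat \<Rightarrow> 'a \<Rightarrow> 'a"
  runitor_qi :: "nat \<Rightarrow> 'a \<Rightarrow> 'a qi"
  associator :: "nat \<Rightarrow> 'a \<Rightarrow> 'a \<Rightarrow> 'a \<Rightarrow> 'a"
  associator_qi :: "nat \<Rightarrow> 'a \<Rightarrow> 'a \<Rightarrow> 'a \<Rightarrow> 'a qi"
  interchanger :: "nat \<Rightarrow> nat \<Rightarrow> 'a \<Rightarrow> 'a \<Rightarrow> 'a \<Rightarrow> 'a \<Rightarrow> 'a"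
  interchanger_qi :: "nat \<Rightarrow> nat \<Rightarrow> 'a \<Rightarrow> 'a \<Rightarrow> 'a \<Rightarrow> 'a \<Rightarrow> 'a qi"
  ident_cmp :: "nat \<Rightarrow> nat \<Rightarrow> 'a \<Rightarrow> 'a \<Rightarrow> 'a"
  ident_cmp_qi :: "nat \<Rightarrow> nat \<Rightarrow> 'a \<Rightarrow> 'a \<Rightarrow> 'a qi"

definition parallel :: "('a, 'm) globular_data_scheme \<Rightarrow> nat \<Rightarrow> 'a \<Rightarrow> 'a \<Rightarrow> bool" where
  "parallel G n x y \<longleftrightarrow> x \<in> cells G n \<and> y \<in> cells G n \<and>
     (\<forall>k. n = Suc k \<longrightarrow> src G k x = src G k y \<and> tgt G k x = tgt G k y)"

primrec hom_cells :: "('a, 'm) globular_data_scheme \<Rightarrow> nat \<Rightarrow> 'a \<Rightarrow> 'a \<Rightarrow> nat \<Rightarrow> 'a set" where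
  "hom_cells G n x y 0 = {f \<in> cells G (n + 1). src G n f = x \<and> tgt G n f = y}"
| "hom_cells G n x y (Suc m) = {a \<in> cells G (n + Suc m + 1).
     src G (n + m + 1) a \<in> hom_cells G n x y m \<and> tgt G (n + m + 1) a \<in> hom_cells G n x y m}"

text \<open>An \<open>m\<close>-cell of \<open>G\<^bsub>x,y\<^esub>\<close> is an \<open>(n+m+1)\<close>-cell of \<open>G\<close>; composition indices are unchanged.\<close>

definition hom_set :: "'a precategory_data \<Rightarrow> nat \<Rightarrow> 'a \<Rightarrow> 'a \<Rightarrow> 'a precategory_data" where
  "hom_set G n x y = \<lparr>
     cells = hom_cells G n x y,
     src = (\<lambda>m. src G (n + m + 1)),
     tgt = (\<lambda>m. tgt G (n + m + 1)),
     ident = (\<lambda>m. ident G (n + m + 1)),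
     cmp = (\<lambda>m. cmp G (n + m + 1)),
     lunitor = (\<lambda>m. lunitor G (n + m + 1)),
     lunitor_qi = (\<lambda>m. lunitor_qi G (n + m + 1)),
     runitor = (\<lambda>m. runitor G (n + m + 1)),
     runitor_qi = (\<lambda>m. runitor_qi G (n + m + 1)),
     associator = (\<lambda>m. associator G (n + m + 1)),
     associator_qi = (\<lambda>m. associator_qi G (n + m + 1)),
     interchanger = (\<lambda>m. interchanger G (n + m + 1)),
     interchanger_qi = (\<lambda>m. interchanger_qi G (n + m + 1)),
     ident_cmp = (\<lambda>m. ident_cmp G (n + m + 1)),
     ident_cmp_qi = (\<lambda>m. ident_cmp_qi G (n + m + 1))\<rparr>"


section \<open>String diagrams\<close>

text \<open>
  A bracketing of a horizontal row of lines.  It is kept as a formal expression, because distinct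
  bracketings may happen to denote the same 1-cell.  Identity 1-cells need not be drawn, so \<open>Unit x\<close>
  contributes no line.  The left-to-right order in the picture is the left-to-right order in
  \<open>f \<star>\<^sub>0 g\<close>; hence the area to the left of a line is its target and the area to its right its source.
\<close>

datatype 'a word = Unit 'a | Line 'a | Beside "'a word" "'a word"

primrec word_lines :: "'a word \<Rightarrow> 'a list" where
  "word_lines (Unit x) = []"
| "word_lines (Line f) = [f]"
| "word_lines (Beside s t) = word_lines s @ word_lines t"

primrec word_cell :: "('a, 'm) composition_data_scheme \<Rightarrow> 'a word \<Rightarrow> 'a" where
  "word_cell G (Unit x) = ident G 0 x"
| "word_cell G (Line f) = f"
| "word_cell G (Beside s t) = cmp G 1 0 (word_cell G s) (word_cell G t)"

primrec word_src :: "('a, 'm) globular_data_scheme \<Rightarrow> 'a word \<Rightarrow> 'a" where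
  "word_src G (Unit x) = x"
| "word_src G (Line f) = src G 0 f"
| "word_src G (Beside s t) = word_src G t"

primrec word_tgt :: "('a, 'm) globular_data_scheme \<Rightarrow> 'a word \<Rightarrow> 'a" where
  "word_tgt G (Unit x) = x"
| "word_tgt G (Line f) = tgt G 0 f"
| "word_tgt G (Beside s t) = word_tgt G s"

primrec word_typed :: "('a, 'm) globular_data_scheme \<Rightarrow> 'a word \<Rightarrow> bool" where
  "word_typed G (Unit x) \<longleftrightarrow> x \<in> cells G 0"
| "word_typed G (Line f) \<longleftrightarrow> f \<in> cells G 1"
| "word_typed G (Beside s t) \<longleftrightarrow> word_typed G s \<and> word_typed G t \<and> word_src G s = word_tgt G t"

subsection \<open>Diagrams, drawings and isotopies\<close>

text \<open>
  A diagram is drawn in the strip of points \<open>(x, y)\<close> with \<open>0 \<le> y \<le> 1\<close> and is read upwards.  Its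
  combinatorial part consists of finitely many nodes and lines (named by natural numbers) with their
  labels and incidences; \<open>None\<close> as an end of a line stands for the bottom (top) edge of the strip.
  \<open>lower_lines\<close> and \<open>upper_lines\<close> list the lines entering and leaving a node from left to right, and
  \<open>lower_word\<close>, \<open>upper_word\<close> say how they are bracketed to give the source and target of its label.
\<close>

record 'a diagram =
  nodes :: "nat set"
  lines :: "nat set"
  node_label :: "nat \<Rightarrow> 'a"
  line_label :: "nat \<Rightarrow> 'a"
  lower_end :: "nat \<Rightarrow> nat option"
  upper_end :: "nat \<Rightarrow> nat option"
  lower_lines :: "nat \<Rightarrow> nat list"
  upper_lines :: "nat \<Rightarrow> nat list"
  lower_word :: "nat \<Rightarrow> 'a word"
  upper_word :: "nat \<Rightarrow> 'a word"

text \<open>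
  The lines of string diagrams for bicategories never turn back, so a line is the graph of a continuous
  function \<open>x = curve e y\<close> of the height.
\<close>

record drawing =
  pos :: "nat \<Rightarrow> real \<times> real"
  curve :: "nat \<Rightarrow> real \<Rightarrow> real"

definition low :: "'a diagram \<Rightarrow> drawing \<Rightarrow> nat \<Rightarrow> real" where
  "low D L e = (case lower_end D e of None \<Rightarrow> 0 | Some v \<Rightarrow> snd (pos L v))"

definition high :: "'a diagram \<Rightarrow> drawing \<Rightarrow> nat \<Rightarrow> real" where
  "high D L e = (case upper_end D e of None \<Rightarrow> 1 | Some v \<Rightarrow> snd (pos L v))"

definition is_diagram :: "'a diagram \<Rightarrow> bool" where
  "is_diagram D \<longleftrightarrow> finite (nodes D) \<and> finite (lines D) \<and>
     (\<forall>e\<in>lines D. \<forall>v. lower_end D e = Some v \<or> upper_end D e = Some v \<longrightarrow> v \<in> nodes D) \<and>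
     (\<forall>v\<in>nodes D. distinct (lower_lines D v) \<and>
        set (lower_lines D v) = {e \<in> lines D. upper_end D e = Some v} \<and>
        distinct (upper_lines D v) \<and>
        set (upper_lines D v) = {e \<in> lines D. lower_end D e = Some v})"

definition is_drawing :: "'a diagram \<Rightarrow> drawing \<Rightarrow> bool" where
  "is_drawing D L \<longleftrightarrow>
     inj_on (pos L) (nodes D) \<and>
     (\<forall>v\<in>nodes D. 0 < snd (pos L v) \<and> snd (pos L v) < 1) \<and>
     (\<forall>e\<in>lines D. low D L e < high D L e \<and> continuous_on {low D L e..high D L e} (curve L e) \<and>
        (\<forall>v. lower_end D e = Some v \<longrightarrow> curve L e (low D L e) = fst (pos L v)) \<and>
        (\<forall>v. upper_end D e = Some v \<longrightarrow> curve L e (high D L e) = fst (pos L v)) \<and>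
        (\<forall>y. low D L e < y \<and> y < high D L e \<longrightarrow> (curve L e y, y) \<notin> pos L ` nodes D)) \<and>
     (\<forall>e\<in>lines D. \<forall>e'\<in>lines D. e \<noteq> e' \<longrightarrow>
        (\<forall>y\<in>{low D L e..high D L e} \<inter> {low D L e'..high D L e'}.
           curve L e y = curve L e' y \<longrightarrow> (curve L e y, y) \<in> pos L ` nodes D)) \<and>
     (\<forall>v\<in>nodes D.
        sorted_wrt (\<lambda>e e'. \<forall>\<^sub>F y in at_left (snd (pos L v)). curve L e y < curve L e' y)
          (lower_lines D v) \<and>
        sorted_wrt (\<lambda>e e'. \<forall>\<^sub>F y in at_right (snd (pos L v)). curve L e y < curve L e' y)
          (upper_lines D v))"

definition planar_isotopy :: "'a diagram \<Rightarrow> (real \<Rightarrow> drawing) \<Rightarrow> bool" where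
  "planar_isotopy D L \<longleftrightarrow>
     (\<forall>t\<in>{0..1}. is_drawing D (L t)) \<and>
     (\<forall>v\<in>nodes D. continuous_on {0..1} (\<lambda>t. pos (L t) v)) \<and>
     (\<forall>e\<in>lines D. continuous_on {(t, y). t \<in> {0..1} \<and> y \<in> {low D (L t) e..high D (L t) e}}
        (\<lambda>(t, y). curve (L t) e y))"

subsection \<open>Horizontal cross-sections and typing\<close>

datatype item = Node nat | Strand nat

fun item_pos :: "drawing \<Rightarrow> real \<Rightarrow> item \<Rightarrow> real" where
  "item_pos L y (Node v) = fst (pos L v)"
| "item_pos L y (Strand e) = curve L e y"

definition items_at :: "'a diagram \<Rightarrow> drawing \<Rightarrow> real \<Rightarrow> item set" where
  "items_at D L y =
     Node ` {v \<in> nodes D. snd (pos L v) = y} \<union>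
     Strand ` {e \<in> lines D. y \<in> {low D L e..high D L e} \<and> (curve L e y, y) \<notin> pos L ` nodes D}"

datatype 'a elem = Wire 'a | Box 'a "'a word" "'a word"

fun item_elem :: "'a diagram \<Rightarrow> item \<Rightarrow> 'a elem" where
  "item_elem D (Node v) = Box (node_label D v) (lower_word D v) (upper_word D v)"
| "item_elem D (Strand e) = Wire (line_label D e)"

definition cross_section :: "'a diagram \<Rightarrow> drawing \<Rightarrow> real \<Rightarrow> 'a elem list" where
  "cross_section D L y =
     map (item_elem D) (sorted_key_list_of_set (item_pos L y) (items_at D L y))"

fun elem_src :: "('a, 'm) globular_data_scheme \<Rightarrow> 'a elem \<Rightarrow> 'a" where
  "elem_src G (Wire f) = src G 0 f"
| "elem_src G (Box \<phi> s t) = word_src G s"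

fun elem_tgt :: "('a, 'm) globular_data_scheme \<Rightarrow> 'a elem \<Rightarrow> 'a" where
  "elem_tgt G (Wire f) = tgt G 0 f"
| "elem_tgt G (Box \<phi> s t) = word_tgt G s"

fun elems_path :: "('a, 'm) globular_data_scheme \<Rightarrow> 'a \<Rightarrow> 'a \<Rightarrow> 'a elem list \<Rightarrow> bool" where
  "elems_path G x y [] \<longleftrightarrow> x = y \<and> x \<in> cells G 0"
| "elems_path G x y (e # es) \<longleftrightarrow> elem_tgt G e = y \<and> elems_path G x (elem_src G e) es"

text \<open>
  Here \<open>x\<close> and \<open>y\<close> label the rightmost and the leftmost area.  The labels of the other areas are
  determined by the adjacent lines, and the last condition says that these labels agree.
\<close>

definition well_typed ::
  "('a, 'm) composition_data_scheme \<Rightarrow> 'a diagram \<Rightarrow> drawing \<Rightarrow> 'a \<Rightarrow> 'a \<Rightarrow> bool" where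
  "well_typed G D L x y \<longleftrightarrow> is_diagram D \<and> is_drawing D L \<and>
     (\<forall>e\<in>lines D. line_label D e \<in> cells G 1) \<and>
     (\<forall>v\<in>nodes D. word_typed G (lower_word D v) \<and> word_typed G (upper_word D v) \<and>
        word_lines (lower_word D v) = map (line_label D) (lower_lines D v) \<and>
        word_lines (upper_word D v) = map (line_label D) (upper_lines D v) \<and>
        word_src G (lower_word D v) = word_src G (upper_word D v) \<and>
        word_tgt G (lower_word D v) = word_tgt G (upper_word D v) \<and>
        arrow G 1 (node_label D v) (word_cell G (lower_word D v)) (word_cell G (upper_word D v))) \<and>
     (\<forall>h\<in>{0..1}. elems_path G x y (cross_section D L h))"

subsection \<open>The 2-cells represented by a diagram\<close>

text \<open>Composites of unitors, associators and their inverses, between formal bracketings.\<close>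

inductive coherence :: "'a precategory_data \<Rightarrow> 'a word \<Rightarrow> 'a word \<Rightarrow> 'a \<Rightarrow> bool" for G where
  coh_ident: "word_typed G s \<Longrightarrow> coherence G s s (ident G 1 (word_cell G s))"
| coh_lunitor: "word_typed G s \<Longrightarrow>
    coherence G (Beside (Unit (word_tgt G s)) s) s (lunitor G 1 (word_cell G s))"
| coh_lunitor_inv: "word_typed G s \<Longrightarrow>
    coherence G s (Beside (Unit (word_tgt G s)) s) (qi_inv (lunitor_qi G 1 (word_cell G s)))"
| coh_runitor: "word_typed G s \<Longrightarrow>
    coherence G (Beside s (Unit (word_src G s))) s (runitor G 1 (word_cell G s))"
| coh_runitor_inv: "word_typed G s \<Longrightarrow>
    coherence G s (Beside s (Unit (word_src G s))) (qi_inv (runitor_qi G 1 (word_cell G s)))"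
| coh_associator: "word_typed G (Beside (Beside r s) t) \<Longrightarrow>
    coherence G (Beside (Beside r s) t) (Beside r (Beside s t))
      (associator G 1 (word_cell G r) (word_cell G s) (word_cell G t))"
| coh_associator_inv: "word_typed G (Beside (Beside r s) t) \<Longrightarrow>
    coherence G (Beside r (Beside s t)) (Beside (Beside r s) t)
      (qi_inv (associator_qi G 1 (word_cell G r) (word_cell G s) (word_cell G t)))"
| coh_beside: "\<lbrakk>coherence G s t c; coherence G s' t' c'; word_typed G (Beside s s')\<rbrakk> \<Longrightarrow>
    coherence G (Beside s s') (Beside t t') (cmp G 2 1 c c')"
| coh_above: "\<lbrakk>coherence G r s c; coherence G s t d\<rbrakk> \<Longrightarrow> coherence G r t (cmp G 2 0 d c)"

text \<open>
  The cells obtained by composing a stack of rows (lowest row first), with any bracketing and with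
  coherence cells inserted anywhere; bare lines contribute identities.  A stack may be cut horizontally
  into an upper and a lower stack, or vertically into a left and a right stack with the same number of rows.
\<close>

inductive rows_cell ::
  "'a precategory_data \<Rightarrow> 'a elem list list \<Rightarrow> 'a word \<Rightarrow> 'a word \<Rightarrow> 'a \<Rightarrow> bool" for G where
  rows_coherence: "coherence G s t c \<Longrightarrow> rows_cell G [] s t c"
| rows_area: "x \<in> cells G 0 \<Longrightarrow> rows_cell G [[]] (Unit x) (Unit x) (ident G 1 (ident G 0 x))"
| rows_wire: "f \<in> cells G 1 \<Longrightarrow> rows_cell G [[Wire f]] (Line f) (Line f) (ident G 1 f)"
| rows_box: "rows_cell G [[Box \<phi> s t]] s t \<phi>"
| rows_above: "\<lbrakk>rows_cell G us r s c; rows_cell G vs s t d\<rbrakk> \<Longrightarrow>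
    rows_cell G (us @ vs) r t (cmp G 2 0 d c)"
| rows_beside: "\<lbrakk>rows_cell G us s t c; rows_cell G vs s' t' c'; length us = length vs;
      word_typed G (Beside s s')\<rbrakk> \<Longrightarrow>
    rows_cell G (map2 (@) us vs) (Beside s s') (Beside t t') (cmp G 2 1 c c')"

text \<open>One row for each height at which there are nodes; several nodes may share a height.\<close>

definition rows :: "'a diagram \<Rightarrow> drawing \<Rightarrow> 'a elem list list" where
  "rows D L = map (cross_section D L) (sorted_list_of_set ((\<lambda>v. snd (pos L v)) ` nodes D))"

text \<open>\<open>s\<close> and \<open>t\<close> are bracketings of the lines on the bottom and the top edge of the strip.\<close>

definition represents ::
  "'a precategory_data \<Rightarrow> 'a diagram \<Rightarrow> drawing \<Rightarrow> 'a \<Rightarrow> 'a \<Rightarrow> 'a word \<Rightarrow> 'a word \<Rightarrow> 'a \<Rightarrow> bool" where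
  "represents G D L x y s t c \<longleftrightarrow>
     word_typed G s \<and> word_src G s = x \<and> word_tgt G s = y \<and>
     map Wire (word_lines s) = cross_section D L 0 \<and>
     word_typed G t \<and> word_src G t = x \<and> word_tgt G t = y \<and>
     map Wire (word_lines t) = cross_section D L 1 \<and>
     rows_cell G (rows D L) s t c"

text \<open>
  The bracketing of a represented cell is not prescribed, so the condition is imposed on all cells
  represented by the two ends of the isotopy that have the same bracketed boundary.  An isotopy keeps
  the combinatorial part of the diagram and moves its drawing continuously from \<open>L 0\<close> to \<open>L 1\<close>.
\<close>

definition respects_graphical_calculus :: "'a precategory_data \<Rightarrow> bool" where
  "respects_graphical_calculus G \<longleftrightarrow>
     (\<forall>D L x y s t c d. well_typed G D (L 0) x y \<and> planar_isotopy D L \<and>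
        represents G D (L 0) x y s t c \<and> represents G D (L 1) x y s t d \<longrightarrow>
        (\<exists>\<theta> q. arrow G 2 \<theta> c d \<and> quasi_invertible_structure G 3 \<theta> q))"


section \<open>Higher pre-categories\<close>

definition qi_arrow ::
  "('a, 'm) composition_data_scheme \<Rightarrow> nat \<Rightarrow> 'a \<Rightarrow> 'a qi \<Rightarrow> 'a \<Rightarrow> 'a \<Rightarrow> bool" where
  "qi_arrow G n \<theta> q a b \<longleftrightarrow> arrow G n \<theta> a b \<and> quasi_invertible_structure G (Suc n) \<theta> q"

locale higher_precategory = globular_set_with_composition G
  for G :: "'a precategory_data" +
  assumes graphical: "respects_graphical_calculus G"
    and graphical_hom: "parallel G n x y \<Longrightarrow> respects_graphical_calculus (hom_set G n x y)"
    and lunitor: "arrow G n f x y \<Longrightarrow>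
      qi_arrow G (Suc n) (lunitor G (Suc n) f) (lunitor_qi G (Suc n) f)
        (cmp G (Suc n) 0 (ident G n y) f) f"
    and runitor: "arrow G n f x y \<Longrightarrow>
      qi_arrow G (Suc n) (runitor G (Suc n) f) (runitor_qi G (Suc n) f)
        (cmp G (Suc n) 0 f (ident G n x)) f"
    and associator: "\<lbrakk>composable G n 0 f g; composable G n 0 g h\<rbrakk> \<Longrightarrow>
      qi_arrow G n (associator G n f g h) (associator_qi G n f g h)
        (cmp G n 0 (cmp G n 0 f g) h) (cmp G n 0 f (cmp G n 0 g h))"
    and interchanger: "\<lbrakk>n > 0; composable G m n f g; composable G m n h j;
        composable G m 0 f h; composable G m 0 g j\<rbrakk> \<Longrightarrow>
      qi_arrow G m (interchanger G m n f g h j) (interchanger_qi G m n f g h j)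
        (cmp G m 0 (cmp G m n f g) (cmp G m n h j))
        (cmp G m n (cmp G m 0 f h) (cmp G m 0 g j))"
    and ident_cmp: "composable G m n f g \<Longrightarrow>
      qi_arrow G (Suc m) (ident_cmp G m n f g) (ident_cmp_qi G m n f g)
        (cmp G (Suc m) (Suc n) (ident G m f) (ident G m g)) (ident G m (cmp G m n f g))"

end

theory Submission
  imports Defs
begin

text \<open>
  Let \<open>S\<close> be the smallest class of cells that contains the bi-invertible cells and is closed under all
  compositions and under passing to the left and right inverses of a cell whose witnessing cells lie
  in \<open>S\<close>.  Every cell of \<open>S\<close> again has a left and a right inverse witnessed by cells of \<open>S\<close>: for a
  composite the inverses are composed, and for a left inverse \<open>h\<close> of \<open>f\<close> with right inverse \<open>g\<close>
  one uses \<open>f h \<rightarrow> (f h) (f g) \<rightarrow> f ((h f) g) \<rightarrow> f g \<rightarrow> id\<close>, whose first step uses an inverse of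
  the witness \<open>f g \<rightarrow> id\<close>.  Hence \<open>S\<close> consists of bi-invertible cells by coinduction.
\<close>

section \<open>Coinduction for the existence of bi-invertible structures\<close>

lemma bi_invertible_structure_dest:
  assumes "bi_invertible_structure G m f b"
  obtains n x y where "m = Suc n" "arrow G n f x y"
    "arrow G n (bi_right_inv b) y x" "arrow G n (bi_left_inv b) y x"
    "arrow G (Suc n) (bi_R b) (cmp G (Suc n) 0 f (bi_right_inv b)) (ident G n y)"
    "arrow G (Suc n) (bi_L b) (cmp G (Suc n) 0 (bi_left_inv b) f) (ident G n x)"
    "bi_invertible_structure G (Suc (Suc n)) (bi_R b) (bi_R_bi b)"
    "bi_invertible_structure G (Suc (Suc n)) (bi_L b) (bi_L_bi b)"
  using assms by (cases rule: bi_invertible_structure.cases) auto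

text \<open>The four arguments are choice functions for inverses and witnesses, indexed by
  dimension. Following the witnesses upwards turns these local choices into one infinite
  tree.\<close>

primcorec unfold_bi ::
  "(nat \<Rightarrow> 'a \<Rightarrow> 'a) \<Rightarrow> (nat \<Rightarrow> 'a \<Rightarrow> 'a) \<Rightarrow> (nat \<Rightarrow> 'a \<Rightarrow> 'a) \<Rightarrow> (nat \<Rightarrow> 'a \<Rightarrow> 'a) \<Rightarrow>
    nat \<Rightarrow> 'a \<Rightarrow> 'a bi" where
  "unfold_bi g h r l m f = BI (g m f) (h m f) (r m f) (l m f)
     (unfold_bi g h r l (Suc m) (r m f)) (unfold_bi g h r l (Suc m) (l m f))"

text \<open>Coinduction applies to a given tree, whereas \<open>step\<close> yields inverses only
  one layer at a time and only existentially. Choice makes them functions of the cell, and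
  \<open>unfold_bi\<close> assembles the tree.\<close>

lemma bi_invertible_structure_exists:
  assumes S: "S m f"
    and step: "\<And>m f. S m f \<Longrightarrow> \<exists>n x y g h r l. m = Suc n \<and> arrow G n f x y \<and>
      arrow G n g y x \<and> arrow G n h y x \<and>
      arrow G m r (cmp G m 0 f g) (ident G n y) \<and> arrow G m l (cmp G m 0 h f) (ident G n x) \<and>
      S (Suc m) r \<and> S (Suc m) l"
  shows "\<exists>b. bi_invertible_structure G m f b"
proof -
  \<comment> \<open>With \<open>S m f\<close> moved inside the existentials the choice functions are
    total; their values outside \<open>S\<close> are arbitrary.\<close>
  have "\<forall>m f. \<exists>g h r l. S m f \<longrightarrow> (\<exists>n x y. m = Suc n \<and> arrow G n f x y \<and>
      arrow G n g y x \<and> arrow G n h y x \<and>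
      arrow G m r (cmp G m 0 f g) (ident G n y) \<and> arrow G m l (cmp G m 0 h f) (ident G n x) \<and>
      S (Suc m) r \<and> S (Suc m) l)"
    using step by meson
  then obtain g h r l where choice: "\<And>m f. S m f \<Longrightarrow> \<exists>n x y. m = Suc n \<and> arrow G n f x y \<and>
      arrow G n (g m f) y x \<and> arrow G n (h m f) y x \<and>
      arrow G m (r m f) (cmp G m 0 f (g m f)) (ident G n y) \<and>
      arrow G m (l m f) (cmp G m 0 (h m f) f) (ident G n x) \<and>
      S (Suc m) (r m f) \<and> S (Suc m) (l m f)"
    by metis
  have "bi_invertible_structure G m f b" if "S m f \<and> b = unfold_bi g h r l m f" for m f b
    using that
  proof (coinduction arbitrary: m f b)
    case bi_invertible_structure
    then have "S m f" and b: "b = unfold_bi g h r l m f" by auto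
    from choice[OF this(1)] show ?case
      \<comment> \<open>A single unfolding exposes the root; the two subtrees are again of the form
        \<open>unfold_bi\<close>, at the witnesses and one dimension higher.\<close>
      unfolding b by (subst unfold_bi.code) auto
  qed
  with S show ?thesis by blast
qed

text \<open>The quasi-inverse serves as both the left and the right inverse.\<close>

lemma quasi_invertible_imp_bi_invertible:
  assumes "quasi_invertible_structure G m f q"
  shows "\<exists>b. bi_invertible_structure G m f b"
proof (rule bi_invertible_structure_exists[where S = "\<lambda>m f. \<exists>q. quasi_invertible_structure G m f q"])
  show "\<exists>q. quasi_invertible_structure G m f q" using assms by blast
next
  fix m f
  assume "\<exists>q. quasi_invertible_structure G m f q"
  then obtain q where "quasi_invertible_structure G m f q" by blast
  then show "\<exists>n x y g h r l. m = Suc n \<and> arrow G n f x y \<and>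
      arrow G n g y x \<and> arrow G n h y x \<and>
      arrow G m r (cmp G m 0 f g) (ident G n y) \<and> arrow G m l (cmp G m 0 h f) (ident G n x) \<and>
      (\<exists>q. quasi_invertible_structure G (Suc m) r q) \<and>
      (\<exists>q. quasi_invertible_structure G (Suc m) l q)"
    by (cases rule: quasi_invertible_structure.cases) blast
qed

section \<open>Quasi-inverses and the closure class\<close>

lemma quasi_inverse_arrow:
  assumes "quasi_invertible_structure G (Suc n) f q" "arrow G n f x y"
  shows "arrow G n (qi_inv q) y x"
  using assms by (cases rule: quasi_invertible_structure.cases) (auto simp: arrow_def)

text \<open>The definition is symmetric: exchange the cell with its inverse and the right witness
  with the left one.\<close>

lemma quasi_inverse_quasi_invertible:
  assumes "quasi_invertible_structure G m f q"
  shows "\<exists>q'. quasi_invertible_structure G m (qi_inv q) q'"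
  using assms
  by (cases rule: quasi_invertible_structure.cases)
    (auto intro: quasi_invertible_structure_intro)

text \<open>In the rules for inverses the witnesses need only lie in the class itself, because the
  witnesses constructed later are known only to do so.\<close>

inductive inverse_closure :: "('a, 'm) composition_data_scheme \<Rightarrow> nat \<Rightarrow> 'a \<Rightarrow> bool" for G where
  base: "bi_invertible_structure G m f b \<Longrightarrow> inverse_closure G m f"
| cmp: "\<lbrakk>inverse_closure G m f; inverse_closure G m g; composable G m k f g\<rbrakk> \<Longrightarrow>
    inverse_closure G m (cmp G m k f g)"
| right_inv: "\<lbrakk>arrow G n f x y; arrow G n g y x; arrow G n h y x;
    arrow G (Suc n) r (cmp G (Suc n) 0 f g) (ident G n y);
    arrow G (Suc n) l (cmp G (Suc n) 0 h f) (ident G n x);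
    inverse_closure G (Suc (Suc n)) r; inverse_closure G (Suc (Suc n)) l\<rbrakk> \<Longrightarrow>
    inverse_closure G (Suc n) g"
| left_inv: "\<lbrakk>arrow G n f x y; arrow G n g y x; arrow G n h y x;
    arrow G (Suc n) r (cmp G (Suc n) 0 f g) (ident G n y);
    arrow G (Suc n) l (cmp G (Suc n) 0 h f) (ident G n x);
    inverse_closure G (Suc (Suc n)) r; inverse_closure G (Suc (Suc n)) l\<rbrakk> \<Longrightarrow>
    inverse_closure G (Suc n) h"

lemma inverse_closure_quasi_invertible:
  "quasi_invertible_structure G m f q \<Longrightarrow> inverse_closure G m f"
  using quasi_invertible_imp_bi_invertible inverse_closure.base by metis

text \<open>Equality up to a cell of the class. The relation is kept directed, since reversing a
  link requires an inverse of the connecting cell.\<close>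

definition linked :: "('a, 'm) composition_data_scheme \<Rightarrow> nat \<Rightarrow> 'a \<Rightarrow> 'a \<Rightarrow> bool" where
  "linked G n a b \<longleftrightarrow> (\<exists>\<theta>. arrow G n \<theta> a b \<and> inverse_closure G (Suc n) \<theta>)"

text \<open>One layer of the bi-invertible definition, with membership in the class in place of
  bi-invertibility of the witnesses.\<close>

definition two_sided :: "('a, 'm) composition_data_scheme \<Rightarrow> nat \<Rightarrow> 'a \<Rightarrow> 'a \<Rightarrow> 'a \<Rightarrow> bool" where
  "two_sided G n f x y \<longleftrightarrow> arrow G n f x y \<and> (\<exists>g h. arrow G n g y x \<and> arrow G n h y x \<and>
     linked G (Suc n) (cmp G (Suc n) 0 f g) (ident G n y) \<and>
     linked G (Suc n) (cmp G (Suc n) 0 h f) (ident G n x))"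

text \<open>A right inverse of \<open>r\<close> runs from \<open>b\<close> to \<open>a\<close>, and
  it lies in the class by closure under right inverses.\<close>

lemma linked_two_sided_sym:
  assumes "arrow G n r a b" "two_sided G n r a b"
  shows "linked G n b a"
proof -
  from assms(2) obtain g h where gh: "arrow G n g b a" "arrow G n h b a"
    "linked G (Suc n) (cmp G (Suc n) 0 r g) (ident G n b)"
    "linked G (Suc n) (cmp G (Suc n) 0 h r) (ident G n a)"
    unfolding two_sided_def by blast
  then have "inverse_closure G (Suc n) g"
    using inverse_closure.right_inv[OF assms(1)] unfolding linked_def by blast
  with gh(1) show ?thesis unfolding linked_def by blast
qed

lemma linked_qi_arrow: "qi_arrow G n \<theta> q a b \<Longrightarrow> linked G n a b"
  unfolding qi_arrow_def linked_def by (blast intro: inverse_closure_quasi_invertible)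

text \<open>Coherence cells can be reversed at once, since their quasi-inverses are quasi-invertible
  too.\<close>

lemma linked_qi_arrow_sym: "qi_arrow G n \<theta> q a b \<Longrightarrow> linked G n b a"
  unfolding qi_arrow_def linked_def
  using inverse_closure_quasi_invertible quasi_inverse_quasi_invertible quasi_inverse_arrow by meson

section \<open>Calculus of links in a higher pre-category\<close>

context higher_precategory
begin

lemma composable_arrows:
  "\<lbrakk>arrow G n f y z; arrow G n g x y\<rbrakk> \<Longrightarrow> composable G (Suc n) 0 f g"
  by (simp add: arrow_def)

lemma cmp_arrow:
  "\<lbrakk>arrow G n f y z; arrow G n g x y\<rbrakk> \<Longrightarrow> arrow G n (cmp G (Suc n) 0 f g) x z"
  using cmp_0_arrow[of n f g] by (auto simp: arrow_def)

lemma composable_Suc_arrows: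
  "\<lbrakk>arrow G n f x y; arrow G n g u v; composable G n k x u; composable G n k y v\<rbrakk> \<Longrightarrow>
    composable G (Suc n) (Suc k) f g"
  by (simp add: arrow_def)

lemma cmp_Suc_arrows:
  "\<lbrakk>arrow G n f x y; arrow G n g u v; composable G n k x u; composable G n k y v\<rbrakk> \<Longrightarrow>
    arrow G n (cmp G (Suc n) (Suc k) f g) (cmp G n k x u) (cmp G n k y v)"
  using cmp_Suc_arrow[of n k f g] by (auto simp: arrow_def)

text \<open>An identity is its own quasi-inverse, with the left unitor at that identity as both
  witnesses.\<close>

lemma inverse_closure_ident:
  assumes "x \<in> cells G n"
  shows "inverse_closure G (Suc n) (ident G n x)"
proof -
  have i: "arrow G n (ident G n x) x x" using ident_arrow assms .
  from lunitor[OF i] have "arrow G (Suc n) (lunitor G (Suc n) (ident G n x))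
      (cmp G (Suc n) 0 (ident G n x) (ident G n x)) (ident G n x)"
    "quasi_invertible_structure G (Suc (Suc n)) (lunitor G (Suc n) (ident G n x))
      (lunitor_qi G (Suc n) (ident G n x))"
    unfolding qi_arrow_def by auto
  then have "quasi_invertible_structure G (Suc n) (ident G n x)
      (QI (ident G n x) (lunitor G (Suc n) (ident G n x)) (lunitor G (Suc n) (ident G n x))
        (lunitor_qi G (Suc n) (ident G n x)) (lunitor_qi G (Suc n) (ident G n x)))"
    using i by (intro quasi_invertible_structure_intro)
  then show ?thesis by (rule inverse_closure_quasi_invertible)
qed

lemma linked_refl: "x \<in> cells G n \<Longrightarrow> linked G n x x"
  unfolding linked_def using ident_arrow inverse_closure_ident by blast

lemma linked_trans [trans]:
  assumes "linked G n a b" "linked G n b c"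
  shows "linked G n a c"
proof -
  from assms obtain r s where "arrow G n r a b" "inverse_closure G (Suc n) r"
    "arrow G n s b c" "inverse_closure G (Suc n) s"
    unfolding linked_def by blast
  then show ?thesis
    unfolding linked_def by (meson cmp_arrow composable_arrows inverse_closure.cmp)
qed

lemma linked_cmp:
  assumes "linked G n a b" "linked G n c d" "composable G n k a c" "composable G n k b d"
  shows "linked G n (cmp G n k a c) (cmp G n k b d)"
proof -
  from assms(1,2) obtain r s where "arrow G n r a b" "inverse_closure G (Suc n) r"
    "arrow G n s c d" "inverse_closure G (Suc n) s"
    unfolding linked_def by blast
  then show ?thesis
    unfolding linked_def
    by (meson cmp_Suc_arrows composable_Suc_arrows assms(3,4) inverse_closure.cmp)
qed

lemma linked_whisker_left:
  assumes "linked G (Suc n) a b" "arrow G n f y z" "arrow G n a x y" "arrow G n b x y"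
  shows "linked G (Suc n) (cmp G (Suc n) 0 f a) (cmp G (Suc n) 0 f b)"
  using assms by (intro linked_cmp linked_refl) (auto simp: arrow_def)

lemma linked_whisker_right:
  assumes "linked G (Suc n) a b" "arrow G n f x y" "arrow G n a y z" "arrow G n b y z"
  shows "linked G (Suc n) (cmp G (Suc n) 0 a f) (cmp G (Suc n) 0 b f)"
  using assms by (intro linked_cmp linked_refl) (auto simp: arrow_def)

lemma linked_assoc:
  assumes "arrow G n f y z" "arrow G n g x y" "arrow G n h w x"
  shows "linked G (Suc n) (cmp G (Suc n) 0 (cmp G (Suc n) 0 f g) h)
      (cmp G (Suc n) 0 f (cmp G (Suc n) 0 g h))"
    and "linked G (Suc n) (cmp G (Suc n) 0 f (cmp G (Suc n) 0 g h))
      (cmp G (Suc n) 0 (cmp G (Suc n) 0 f g) h)"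
  using associator[of "Suc n" f g h] composable_arrows assms
  by (meson linked_qi_arrow linked_qi_arrow_sym)+

text \<open>Reassociate until \<open>g h\<close> stands together, contract it to an identity, and
  absorb that into \<open>k\<close> by the left unitor.\<close>

lemma linked_cancel_inner:
  assumes "arrow G n f y z" "arrow G n g x y" "arrow G n h y x" "arrow G n k w y"
    and "linked G (Suc n) (cmp G (Suc n) 0 g h) (ident G n y)"
  shows "linked G (Suc n) (cmp G (Suc n) 0 (cmp G (Suc n) 0 f g) (cmp G (Suc n) 0 h k))
    (cmp G (Suc n) 0 f k)"
proof -
  let ?c = "cmp G (Suc n) 0"
  have y: "arrow G n (ident G n y) y y"
    using assms(1) ident_arrow by (simp add: arrow_def)
  have gh: "arrow G n (?c g h) y y" using assms cmp_arrow by blast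
  have "linked G (Suc n) (?c (?c f g) (?c h k)) (?c f (?c g (?c h k)))"
    using linked_assoc(1) assms cmp_arrow by blast
  also have "linked G (Suc n) \<dots> (?c f (?c (?c g h) k))"
    using linked_whisker_left[OF linked_assoc(2)] assms cmp_arrow by meson
  also have "linked G (Suc n) \<dots> (?c f (?c (ident G n y) k))"
    using linked_whisker_left[OF linked_whisker_right] assms cmp_arrow y gh by meson
  also have "linked G (Suc n) \<dots> (?c f k)"
    using linked_whisker_left[OF linked_qi_arrow[OF lunitor]] assms cmp_arrow y by meson
  finally show ?thesis .
qed

section \<open>Invertibility of composites and of inverses\<close>

lemma two_sided_cmp_0:
  assumes "two_sided G n f y z" "two_sided G n g x y"
  shows "two_sided G n (cmp G (Suc n) 0 f g) x z"
proof -
  let ?c = "cmp G (Suc n) 0"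
  from assms(1) obtain f1 f2 where f: "arrow G n f y z" "arrow G n f1 z y" "arrow G n f2 z y"
    "linked G (Suc n) (?c f f1) (ident G n z)" "linked G (Suc n) (?c f2 f) (ident G n y)"
    unfolding two_sided_def by blast
  from assms(2) obtain g1 g2 where g: "arrow G n g x y" "arrow G n g1 y x" "arrow G n g2 y x"
    "linked G (Suc n) (?c g g1) (ident G n y)" "linked G (Suc n) (?c g2 g) (ident G n x)"
    unfolding two_sided_def by blast
  \<comment> \<open>The inverses of \<open>f g\<close> are composed in reverse order, so that the
    inner pair cancels first and the outer pair then contracts.\<close>
  have "linked G (Suc n) (?c (?c f g) (?c g1 f1)) (ident G n z)"
    using linked_trans[OF linked_cancel_inner[OF f(1) g(1,2) f(2) g(4)] f(4)] .
  moreover have "linked G (Suc n) (?c (?c g2 f2) (?c f g)) (ident G n x)"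
    using linked_trans[OF linked_cancel_inner[OF g(3) f(3,1) g(1) f(5)] g(5)] .
  ultimately show ?thesis
    unfolding two_sided_def using f(1-3) g(1-3) cmp_arrow by blast
qed

text \<open>For the higher compositions inverses are taken componentwise: the interchanger pairs
  each cell with its inverse, both pairs contract, and \<open>ident_cmp\<close> merges the two
  identities.\<close>

lemma linked_cmp_Suc_inverse:
  assumes "arrow G n f x y" "arrow G n f' y x" "arrow G n g u v" "arrow G n g' v u"
    and "composable G n k x u" "composable G n k y v"
    and "linked G (Suc n) (cmp G (Suc n) 0 f f') (ident G n y)"
    and "linked G (Suc n) (cmp G (Suc n) 0 g g') (ident G n v)"
  shows "linked G (Suc n) (cmp G (Suc n) 0 (cmp G (Suc n) (Suc k) f g) (cmp G (Suc n) (Suc k) f' g'))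
    (ident G n (cmp G n k y v))"
proof -
  let ?c = "cmp G (Suc n) 0" and ?d = "cmp G (Suc n) (Suc k)"
  have y: "arrow G n (ident G n y) y y" and v: "arrow G n (ident G n v) v v"
    using assms(1,3) ident_arrow by (simp_all add: arrow_def)
  have "linked G (Suc n) (?c (?d f g) (?d f' g')) (?d (?c f f') (?c g g'))"
    using linked_qi_arrow[OF interchanger] composable_Suc_arrows composable_arrows assms
    by (meson zero_less_Suc)
  also have "linked G (Suc n) \<dots> (?d (ident G n y) (ident G n v))"
    using linked_cmp assms(7,8) composable_Suc_arrows[OF _ _ assms(6,6)]
      cmp_arrow[OF assms(1,2)] cmp_arrow[OF assms(3,4)] y v by blast
  also have "linked G (Suc n) \<dots> (ident G n (cmp G n k y v))"
    using linked_qi_arrow[OF ident_cmp] assms(6) by blast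
  finally show ?thesis .
qed

lemma two_sided_cmp_Suc:
  assumes "two_sided G n f x y" "two_sided G n g u v"
    and k: "composable G n k x u" "composable G n k y v"
  shows "two_sided G n (cmp G (Suc n) (Suc k) f g) (cmp G n k x u) (cmp G n k y v)"
proof -
  let ?c = "cmp G (Suc n) 0"
  from assms(1) obtain f1 f2 where f: "arrow G n f x y" "arrow G n f1 y x" "arrow G n f2 y x"
    "linked G (Suc n) (?c f f1) (ident G n y)" "linked G (Suc n) (?c f2 f) (ident G n x)"
    unfolding two_sided_def by blast
  from assms(2) obtain g1 g2 where g: "arrow G n g u v" "arrow G n g1 v u" "arrow G n g2 v u"
    "linked G (Suc n) (?c g g1) (ident G n v)" "linked G (Suc n) (?c g2 g) (ident G n u)"
    unfolding two_sided_def by blast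
  show ?thesis
    unfolding two_sided_def
    \<comment> \<open>Inverses swap source and target, hence the boundary conditions in the order
      \<open>k(2,1)\<close>. The left inverse case is the previous lemma with the roles of cell and
      inverse exchanged.\<close>
    using cmp_Suc_arrows[OF f(1) g(1) k] cmp_Suc_arrows[OF f(2) g(2) k(2,1)]
      cmp_Suc_arrows[OF f(3) g(3) k(2,1)]
      linked_cmp_Suc_inverse[OF f(1,2) g(1,2) k f(4) g(4)]
      linked_cmp_Suc_inverse[OF f(3,1) g(3,1) k(2,1) f(5) g(5)]
    by blast
qed

text \<open>Here \<open>f\<close> is both inverses of \<open>h\<close>: on the right by
  \<open>hf\<close>, on the left by the chain below. The second link in \<open>fg\<close> serves to
  insert \<open>f g\<close> in place of an identity.\<close>

lemma two_sided_left_inverse: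
  assumes f: "arrow G n f x y" and g: "arrow G n g y x" and h: "arrow G n h y x"
    and fg: "linked G (Suc n) (cmp G (Suc n) 0 f g) (ident G n y)"
      "linked G (Suc n) (ident G n y) (cmp G (Suc n) 0 f g)"
    and hf: "linked G (Suc n) (cmp G (Suc n) 0 h f) (ident G n x)"
  shows "two_sided G n h y x"
proof -
  let ?c = "cmp G (Suc n) 0"
  have y: "arrow G n (ident G n y) y y" using f ident_arrow by (simp add: arrow_def)
  have "linked G (Suc n) (?c f h) (?c (?c f h) (ident G n y))"
    using linked_qi_arrow_sym[OF runitor] cmp_arrow[OF f h] .
  also have "linked G (Suc n) \<dots> (?c (?c f h) (?c f g))"
    using linked_whisker_left[OF fg(2)] cmp_arrow[OF f h] y cmp_arrow[OF f g] .
  also have "linked G (Suc n) \<dots> (?c f g)"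
    using linked_cancel_inner[OF f h f g hf] .
  also note fg(1)
  finally show ?thesis using f h hf unfolding two_sided_def by blast
qed

text \<open>The mirror image: \<open>f\<close> is both inverses of \<open>g\<close>, and now
  \<open>h f\<close> is inserted on the left.\<close>

lemma two_sided_right_inverse:
  assumes f: "arrow G n f x y" and g: "arrow G n g y x" and h: "arrow G n h y x"
    and fg: "linked G (Suc n) (cmp G (Suc n) 0 f g) (ident G n y)"
    and hf: "linked G (Suc n) (cmp G (Suc n) 0 h f) (ident G n x)"
      "linked G (Suc n) (ident G n x) (cmp G (Suc n) 0 h f)"
  shows "two_sided G n g y x"
proof -
  let ?c = "cmp G (Suc n) 0"
  have x: "arrow G n (ident G n x) x x" using f ident_arrow by (simp add: arrow_def)
  have "linked G (Suc n) (?c g f) (?c (ident G n x) (?c g f))"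
    using linked_qi_arrow_sym[OF lunitor] cmp_arrow[OF g f] .
  also have "linked G (Suc n) \<dots> (?c (?c h f) (?c g f))"
    using linked_whisker_right[OF hf(2)] cmp_arrow[OF g f] x cmp_arrow[OF h f] .
  also have "linked G (Suc n) \<dots> (?c h f)"
    using linked_cancel_inner[OF h f g f fg] .
  also note hf(1)
  finally show ?thesis using f g fg unfolding two_sided_def by blast
qed

section \<open>The closure class consists of bi-invertible cells\<close>

lemma two_sided_arrow_cong:
  "\<lbrakk>two_sided G n f u v; arrow G n f x y\<rbrakk> \<Longrightarrow> two_sided G n f x y"
  by (auto simp: two_sided_def arrow_def)

text \<open>Induction on the class. In the two inverse cases the induction hypothesis on a witness
  supplies its inverse, and so the reversed link that the insertion step uses.\<close>

lemma inverse_closure_two_sided: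
  "inverse_closure G m f \<Longrightarrow> \<exists>n x y. m = Suc n \<and> two_sided G n f x y"
proof (induction rule: inverse_closure.induct)
  case (base m f b)
  then show ?case
    by (rule bi_invertible_structure_dest)
      (unfold two_sided_def linked_def, blast intro: inverse_closure.base)
next
  case (cmp m f g k)
  then obtain n x y u v where m: "m = Suc n" and f: "two_sided G n f x y" and g: "two_sided G n g u v"
    by auto
  have arrows: "arrow G n f x y" "arrow G n g u v" using f g unfolding two_sided_def by auto
  show ?case
  proof (cases k)
    case 0
    \<comment> \<open>For \<open>\<star>\<^sub>0\<close> the two boundaries given by the induction
      hypotheses must meet.\<close>
    then have "v = x" using cmp.hyps(3) arrows m by (simp add: arrow_def)
    with 0 m f g show ?thesis using two_sided_cmp_0 by blast
  next
    case (Suc k')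
    then have "composable G n k' x u" "composable G n k' y v"
      using cmp.hyps(3) arrows m by (auto simp: arrow_def)
    with Suc m f g show ?thesis using two_sided_cmp_Suc by blast
  qed
next
  case (right_inv n f x y g h r l)
  then have "two_sided G (Suc n) l (cmp G (Suc n) 0 h f) (ident G n x)"
    using two_sided_arrow_cong by blast
  then have "linked G (Suc n) (ident G n x) (cmp G (Suc n) 0 h f)"
    by (rule linked_two_sided_sym[OF right_inv.hyps(5)])
  moreover have "linked G (Suc n) (cmp G (Suc n) 0 f g) (ident G n y)"
    "linked G (Suc n) (cmp G (Suc n) 0 h f) (ident G n x)"
    using right_inv.hyps unfolding linked_def by auto
  ultimately have "two_sided G n g y x"
    by (intro two_sided_right_inverse[OF right_inv.hyps(1-3)])
  then show ?case by blast
next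
  case (left_inv n f x y g h r l)
  then have "two_sided G (Suc n) r (cmp G (Suc n) 0 f g) (ident G n y)"
    using two_sided_arrow_cong by blast
  then have "linked G (Suc n) (ident G n y) (cmp G (Suc n) 0 f g)"
    by (rule linked_two_sided_sym[OF left_inv.hyps(4)])
  moreover have "linked G (Suc n) (cmp G (Suc n) 0 f g) (ident G n y)"
    "linked G (Suc n) (cmp G (Suc n) 0 h f) (ident G n x)"
    using left_inv.hyps unfolding linked_def by auto
  ultimately have "two_sided G n h y x"
    by (intro two_sided_left_inverse[OF left_inv.hyps(1-3)])
  then show ?case by blast
qed

text \<open>The preceding lemma says that the class satisfies the step condition of the coinduction
  principle.\<close>

lemma inverse_closure_bi_invertible:
  assumes "inverse_closure G m f"
  shows "\<exists>b. bi_invertible_structure G m f b"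
proof (rule bi_invertible_structure_exists[where S = "inverse_closure G", OF assms])
  fix m f
  assume "inverse_closure G m f"
  from inverse_closure_two_sided[OF this]
  show "\<exists>n x y g h r l. m = Suc n \<and> arrow G n f x y \<and>
      arrow G n g y x \<and> arrow G n h y x \<and>
      arrow G m r (cmp G m 0 f g) (ident G n y) \<and> arrow G m l (cmp G m 0 h f) (ident G n x) \<and>
      inverse_closure G (Suc m) r \<and> inverse_closure G (Suc m) l"
    unfolding two_sided_def linked_def by blast
qed

end

theorem lemma14:
  fixes G :: "'a precategory_data"
    and n :: nat
    and f fstar starf fR fL :: 'a
    and bR bL :: "'a bi"
  assumes "higher_precategory G"
    and "n > 0"
    and "f \<in> cells G n"
    and "bi_invertible_structure G n f (BI fstar starf fR fL bR bL)"
  shows "(\<exists>b. bi_invertible_structure G n starf b) \<and> (\<exists>b'. bi_invertible_structure G n fstar b')"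
proof -
  interpret higher_precategory G by fact
  from assms(4) obtain m x y where n: "n = Suc m" and arrows: "arrow G m f x y"
    "arrow G m fstar y x" "arrow G m starf y x"
    "arrow G (Suc m) fR (cmp G (Suc m) 0 f fstar) (ident G m y)"
    "arrow G (Suc m) fL (cmp G (Suc m) 0 starf f) (ident G m x)"
    and "bi_invertible_structure G (Suc (Suc m)) fR bR"
      "bi_invertible_structure G (Suc (Suc m)) fL bL"
    by (rule bi_invertible_structure_dest) auto
  \<comment> \<open>The witnesses enter the class as base cells; both inverses then follow by its
    closure rules.\<close>
  then have "inverse_closure G (Suc (Suc m)) fR" "inverse_closure G (Suc (Suc m)) fL"
    by (auto intro: inverse_closure.base)
  with inverse_closure.left_inv[OF arrows] inverse_closure.right_inv[OF arrows]
  show ?thesis unfolding n using inverse_closure_bi_invertible by blast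
qed

end
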